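(* Let $t\ge 1$ be an integer. For $n\ge 1$, let $g_t(n)$ denote the number of overpartitions of $n$ in which the difference between the largest part and the smallest part is at most $t$, and such that if this difference is exactly $t$, then the largest parts are not overlined. Then, as formal power series in $q$, $$\sum_{n\ge 1} g_t(n) q^n=\frac{1}{1-q^t}\left(\frac{(-q;q)_t}{(q;q)_t}-1\right).$$
   Context: An overpartition of a positive integer $n$ is a partition of $n$ (a non-increasing sequence of positive integers summing to $n$) in which the first occurrence of each distinct part may be overlined. For instance, the overpartitions of $4$ counted by $g_1(4)$ are $4,\ \overline{4},\ 2+2,\ \overline{2}+2,\ 2+1+1,\ 2+\overline{1}+1,\ 1+1+1+1,\ \overline{1}+1+1+1$, so $g_1(4)=8$. Notation: $(a;q)_n=\prod_{k=0}^{n-1}(1-aq^k)$. *)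

theory Defs
  imports "HOL-Computational_Algebra.Formal_Power_Series"
begin

text \<open>
  The entry \<open>(a, b)\<close> of a list stands for a part of size \<open>a\<close>, which is overlined iff \<open>b\<close> holds.
  The last condition below says that only the first occurrence of a part can be overlined.
\<close>

definition overpartitions :: "nat \<Rightarrow> (nat \<times> bool) list set" where
  "overpartitions n = {ps.
     sorted_wrt (\<ge>) (map fst ps) \<and>
     (\<forall>p\<in>set ps. fst p > 0) \<and>
     sum_list (map fst ps) = n \<and>
     (\<forall>i<length ps. snd (ps ! i) \<longrightarrow> (\<forall>j<i. fst (ps ! j) \<noteq> fst (ps ! i)))}"

text \<open>The following two are only meaningful for nonempty lists.\<close>

definition largest_part :: "(nat \<times> bool) list \<Rightarrow> nat" where
  "largest_part ps = Max (fst ` set ps)"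

definition smallest_part :: "(nat \<times> bool) list \<Rightarrow> nat" where
  "smallest_part ps = Min (fst ` set ps)"

definition g :: "nat \<Rightarrow> nat \<Rightarrow> nat" where
  "g t n = card {ps \<in> overpartitions n.
     largest_part ps - smallest_part ps \<le> t \<and>
     (largest_part ps - smallest_part ps = t \<longrightarrow> (largest_part ps, True) \<notin> set ps)}"

definition qpochhammer :: "'a::comm_ring_1 \<Rightarrow> 'a \<Rightarrow> nat \<Rightarrow> 'a" where
  "qpochhammer a q n = (\<Prod>k<n. 1 - a * q ^ k)"

text \<open>The cardinality in the definition of \<^const>\<open>g\<close> is that of a finite set:\<close>

lemma finite_overpartitions: "finite (overpartitions n)"
proof (rule finite_subset)
  have len: "length ps \<le> sum_list (map fst ps)" if "\<forall>p\<in>set ps. fst p > 0"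
    for ps :: "(nat \<times> bool) list"
    using that by (induction ps) auto
  have mem: "fst p \<le> sum_list (map fst ps)" if "p \<in> set ps"
    for p and ps :: "(nat \<times> bool) list"
    using that by (intro member_le_sum_list) auto
  show "overpartitions n \<subseteq> {ps. set ps \<subseteq> {..n} \<times> UNIV \<and> length ps \<le> n}"
    using len mem by (fastforce simp: overpartitions_def)
qed (intro finite_lists_length_le finite_cartesian_product; simp)

end

theory Submission
  imports Defs
begin

unbundle fps_syntax

text \<open>
  Write \<open>r\<^sub>i = (1 + q\<^sup>i) / (1 - q\<^sup>i)\<close> and \<open>A\<^sub>m = r\<^sub>m \<cdots> r\<^bsub>m+t-1\<^esub>\<close>. An overpartition counted by \<open>g t\<close> with
  smallest part \<open>m\<close> has its parts in \<open>{m..m+t}\<close>, with no overlined \<open>m+t\<close>, so these overpartitions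
  have the generating function \<open>S\<^sub>m = (r\<^sub>m - 1) r\<^bsub>m+1\<^esub> \<cdots> r\<^bsub>m+t-1\<^esub> / (1 - q\<^bsup>m+t\<^esup>)\<close>.
  Since \<open>(1 - q\<^sup>t) S\<^sub>m = A\<^sub>m - A\<^bsub>m+1\<^esub>\<close>, the sum over \<open>m \<ge> 1\<close> telescopes to \<open>(A\<^sub>1 - 1) / (1 - q\<^sup>t)\<close>.
\<close>

section \<open>Overpartitions as lists over a set of admissible entries\<close>

definition may_precede :: "nat \<times> bool \<Rightarrow> nat \<times> bool \<Rightarrow> bool" where
  "may_precede p x \<longleftrightarrow> fst x \<le> fst p \<and> (fst x = fst p \<longrightarrow> \<not> snd x)"

text \<open>\<open>may_precede\<close> merges the order and the overlining rule:
  \<open>(k, False)\<close> may precede itself, \<open>(k, True)\<close> may not. Restricting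
  entries rather than sizes makes it possible to admit a plain \<open>m + t\<close> and exclude an
  overlined one.\<close>

definition overlists :: "(nat \<times> bool) set \<Rightarrow> (nat \<times> bool) list set" where
  "overlists A = {ps. sorted_wrt may_precede ps \<and> set ps \<subseteq> A}"

definition of_size :: "nat \<Rightarrow> (nat \<times> bool) list set" where
  "of_size n = {ps. sum_list (map fst ps) = n}"

definition size_gf :: "(nat \<times> bool) list set \<Rightarrow> rat fps" where
  "size_gf S = Abs_fps (\<lambda>n. of_nat (card (S \<inter> of_size n)))"

lemma overpartitions_eq:
  "overpartitions n = overlists ({1..} \<times> UNIV) \<inter> of_size n"
proof -
  have "sorted_wrt may_precede ps \<longleftrightarrow>
      sorted_wrt (\<ge>) (map fst ps) \<and>
      (\<forall>i<length ps. snd (ps ! i) \<longrightarrow> (\<forall>j<i. fst (ps ! j) \<noteq> fst (ps ! i)))" for ps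
  proof -
    \<comment> \<open>\<open>F\<close> and \<open>S\<close> stand for the sizes and overline flags
      by index. The two overlining conditions are contrapositives with \<open>i\<close> and
      \<open>j\<close> exchanged.\<close>
    have "(\<forall>i j. i < j \<longrightarrow> j < N \<longrightarrow> F j \<le> F i \<and> (F j = F i \<longrightarrow> \<not> S j)) \<longleftrightarrow>
        (\<forall>i j. i < j \<longrightarrow> j < N \<longrightarrow> F j \<le> F i) \<and> (\<forall>i<N. S i \<longrightarrow> (\<forall>j<i. F j \<noteq> F i))"
      for N :: nat and S and F :: "nat \<Rightarrow> nat"
      by metis
    thus ?thesis
      unfolding sorted_wrt_map unfolding sorted_wrt_iff_nth_less may_precede_def .
  qed
  moreover have "(\<forall>p\<in>set ps. fst p > 0) \<longleftrightarrow> set ps \<subseteq> {1..} \<times> UNIV" for ps :: "(nat \<times> bool) list"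
    by force
  ultimately show ?thesis
    by (auto simp: overpartitions_def overlists_def of_size_def)
qed

lemma overlists_mono: "A \<subseteq> B \<Longrightarrow> overlists A \<subseteq> overlists B"
  by (auto simp: overlists_def)

lemma finite_overlists:
  assumes "A \<subseteq> {1..} \<times> UNIV"
  shows "finite (overlists A \<inter> of_size n)"
  using finite_overpartitions[of n] overlists_mono[OF assms]
  unfolding overpartitions_eq by (meson Int_mono finite_subset order_refl)

lemma Cons_in_overlists:
  "p # ps \<in> overlists A \<longleftrightarrow> p \<in> A \<and> (\<forall>x\<in>set ps. may_precede p x) \<and> ps \<in> overlists A"
  by (auto simp: overlists_def)

section \<open>Generating functions under union, prefixing and a new largest part\<close>

lemma size_gf_Un:
  assumes "\<And>n. finite (S \<inter> of_size n)" "\<And>n. finite (T \<inter> of_size n)" "S \<inter> T = {}"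
  shows "size_gf (S \<union> T) = size_gf S + size_gf T"
proof (rule fps_ext)
  fix n
  have "card ((S \<union> T) \<inter> of_size n) = card (S \<inter> of_size n) + card (T \<inter> of_size n)"
    unfolding Int_Un_distrib2 by (rule card_Un_disjoint) (use assms in auto)
  thus "size_gf (S \<union> T) $ n = (size_gf S + size_gf T) $ n"
    by (simp add: size_gf_def)
qed

lemma size_gf_Cons: "size_gf (Cons (k, b) ` S) = fps_X ^ k * size_gf S"
proof (rule fps_ext)
  fix n
  have "Cons (k, b) ` S \<inter> of_size n =
      (if n < k then {} else Cons (k, b) ` (S \<inter> of_size (n - k)))"
    by (auto simp: of_size_def)
  thus "size_gf (Cons (k, b) ` S) $ n = (fps_X ^ k * size_gf S) $ n"
    by (simp add: size_gf_def fps_X_power_mult_nth card_image)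
qed

lemma finite_Cons_of_size:
  assumes "\<And>n. finite (S \<inter> of_size n)"
  shows "finite (Cons (k, b) ` S \<inter> of_size n)"
proof (rule finite_subset)
  show "Cons (k, b) ` S \<inter> of_size n \<subseteq> Cons (k, b) ` (S \<inter> of_size (n - k))"
    by (auto simp: of_size_def)
qed (use assms in simp)

text \<open>A list over the larger set either avoids \<open>k\<close>, or starts with a plain
  \<open>k\<close> whose removal leaves a list of the same kind, because plain copies may repeat.
  This gives \<open>U = overlists A + q^k U\<close> for the generating functions.\<close>

lemma size_gf_overlists_insert:
  assumes "A \<subseteq> {1..<k} \<times> UNIV" "k \<ge> 1"
  shows "size_gf (overlists (insert (k, False) A)) * (1 - fps_X ^ k) = size_gf (overlists A)"
proof -
  let ?U = "overlists (insert (k, False) A)"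
  have less: "a < k" if "(a, b) \<in> A" for a b
    using assms that by auto
  hence notin: "(k, b) \<notin> A" for b
    by blast
  have "?U = overlists A \<union> Cons (k, False) ` ?U"
  proof (intro Set.equalityI subsetI)
    fix ps assume ps: "ps \<in> ?U"
    show "ps \<in> overlists A \<union> Cons (k, False) ` ?U"
    proof (cases ps)
      case Nil
      thus ?thesis by (simp add: overlists_def)
    next
      case (Cons p qs)
      show ?thesis
      proof (cases "p = (k, False)")
        case True
        thus ?thesis using ps Cons by (auto simp: Cons_in_overlists)
      next
        case False
        hence "p \<in> A" using ps Cons by (auto simp: Cons_in_overlists)
        \<comment> \<open>Later entries are no larger than the head, so none of them is
          \<open>(k, False)\<close>.\<close>
        hence "fst p < k" using less by (cases p) auto
        hence "set qs \<subseteq> A"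
          using ps Cons by (fastforce simp: overlists_def may_precede_def)
        thus ?thesis using \<open>p \<in> A\<close> ps Cons by (auto simp: overlists_def)
      qed
    qed
  next
    fix ps assume "ps \<in> overlists A \<union> Cons (k, False) ` ?U"
    thus "ps \<in> ?U"
    proof
      assume "ps \<in> overlists A"
      thus ?thesis using overlists_mono[of A "insert (k, False) A"] by auto
    next
      assume "ps \<in> Cons (k, False) ` ?U"
      thus ?thesis
        using less[of k] by (fastforce simp: overlists_def may_precede_def dest: less)
    qed
  qed
  moreover have "size_gf (overlists A \<union> Cons (k, False) ` ?U) =
      size_gf (overlists A) + size_gf (Cons (k, False) ` ?U)"
  proof (rule size_gf_Un)
    show "overlists A \<inter> Cons (k, False) ` ?U = {}"
      by (auto simp: overlists_def notin)
    show "finite (Cons (k, False) ` ?U \<inter> of_size n)" for n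
      by (intro finite_Cons_of_size finite_overlists) (use assms in auto)
    show "finite (overlists A \<inter> of_size n)" for n
      by (intro finite_overlists) (use assms in auto)
  qed
  ultimately have "size_gf ?U = size_gf (overlists A) + fps_X ^ k * size_gf ?U"
    by (metis size_gf_Cons)
  thus ?thesis by (simp add: algebra_simps)
qed

text \<open>An overlined largest size occurs at most once and only in front, so it is an optional
  prefix to a list in which \<open>k\<close> is plain.\<close>

lemma size_gf_overlists_insert_both:
  assumes "A \<subseteq> {1..<k} \<times> UNIV" "k \<ge> 1"
  shows "size_gf (overlists (insert (k, True) (insert (k, False) A))) =
    (1 + fps_X ^ k) * size_gf (overlists (insert (k, False) A))"
proof -
  let ?U = "overlists (insert (k, False) A)"
  let ?L = "overlists (insert (k, True) (insert (k, False) A))"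
  have less: "a < k" if "(a, b) \<in> A" for a b
    using assms that by auto
  hence notin: "(k, b) \<notin> A" for b
    by blast
  have "?L = ?U \<union> Cons (k, True) ` ?U"
  proof (intro Set.equalityI subsetI)
    fix ps assume ps: "ps \<in> ?L"
    show "ps \<in> ?U \<union> Cons (k, True) ` ?U"
    proof (cases ps)
      case Nil
      thus ?thesis by (simp add: overlists_def)
    next
      case (Cons p qs)
      have "fst p \<le> k"
        using ps Cons less by (cases p) (auto simp: overlists_def less_imp_le)
      \<comment> \<open>The head has size at most \<open>k\<close>. If \<open>(k, True)\<close> came
        later, the head would have size exactly \<open>k\<close>, which \<open>may_precede\<close>
        forbids.\<close>
      hence "(k, True) \<notin> set qs"
        using ps Cons by (fastforce simp: overlists_def may_precede_def)
      hence "qs \<in> ?U"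
        using ps Cons by (auto simp: overlists_def)
      thus ?thesis
        using ps Cons by (cases "p = (k, True)") (auto simp: overlists_def)
    qed
  next
    fix ps assume "ps \<in> ?U \<union> Cons (k, True) ` ?U"
    thus "ps \<in> ?L"
    proof
      assume "ps \<in> ?U"
      thus ?thesis by (auto simp: overlists_def)
    next
      assume "ps \<in> Cons (k, True) ` ?U"
      thus ?thesis
        using less[of k] by (fastforce simp: overlists_def may_precede_def dest: less)
    qed
  qed
  moreover have "size_gf (?U \<union> Cons (k, True) ` ?U) = size_gf ?U + size_gf (Cons (k, True) ` ?U)"
  proof (rule size_gf_Un)
    show "?U \<inter> Cons (k, True) ` ?U = {}"
      by (auto simp: overlists_def notin)
    show "finite (?U \<inter> of_size n)" for n
      by (intro finite_overlists) (use assms in auto)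
    thus "finite (Cons (k, True) ` ?U \<inter> of_size n)" for n
      by (rule finite_Cons_of_size)
  qed
  ultimately show ?thesis
    by (simp add: size_gf_Cons algebra_simps)
qed

section \<open>Product formula for intervals of sizes and the telescoping identity\<close>

lemma one_minus_X_power_unit:
  "k \<ge> 1 \<Longrightarrow> (1 - fps_X ^ k :: rat fps) * inverse (1 - fps_X ^ k) = 1"
  by (rule inverse_mult_eq_1') simp

lemma eq_mult_right_inverse:
  fixes a b u v :: "'a :: monoid_mult"
  assumes "a * u = b" "u * v = 1"
  shows "a = b * v"
  using assms by (metis mult.assoc mult.right_neutral)

text \<open>The factor \<open>r_i\<close>: a geometric series for the plain copies of
  \<open>i\<close>, times \<open>1 + q^i\<close> for an optional overlined one.\<close>

definition ratio :: "nat \<Rightarrow> rat fps" where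
  "ratio i = (1 + fps_X ^ i) * inverse (1 - fps_X ^ i)"

lemma size_gf_overlists_last_plain:
  assumes "1 \<le> m" "m \<le> k"
  shows "size_gf (overlists (insert (k, False) ({m..<k} \<times> UNIV))) =
    size_gf (overlists ({m..<k} \<times> UNIV)) * inverse (1 - fps_X ^ k)"
proof -
  have "size_gf (overlists (insert (k, False) ({m..<k} \<times> UNIV))) * (1 - fps_X ^ k) =
      size_gf (overlists ({m..<k} \<times> UNIV))"
    by (rule size_gf_overlists_insert) (use assms in auto)
  thus ?thesis
    by (rule eq_mult_right_inverse) (use assms in \<open>simp add: one_minus_X_power_unit\<close>)
qed

lemma size_gf_overlists_interval:
  assumes "1 \<le> m" "m \<le> k"
  shows "size_gf (overlists ({m..<k} \<times> UNIV)) = prod ratio {m..<k}"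
  using assms(2)
proof (induction k rule: dec_induct)
  case base
  have "overlists ({m..<m} \<times> UNIV) = {[]}"
    by (auto simp: overlists_def)
  moreover have "{[]} \<inter> of_size n = (if n = 0 then {[]} else {})" for n
    by (auto simp: of_size_def)
  ultimately show ?case
    by (auto simp: size_gf_def fps_eq_iff)
next
  case (step k)
  have "{m..<Suc k} \<times> UNIV = insert (k, True) (insert (k, False) ({m..<k} \<times> UNIV))"
    using step by (auto simp: less_Suc_eq)
  hence "size_gf (overlists ({m..<Suc k} \<times> UNIV)) =
      (1 + fps_X ^ k) * size_gf (overlists (insert (k, False) ({m..<k} \<times> UNIV)))"
    using assms(1) step.hyps by (simp only:) (rule size_gf_overlists_insert_both; auto)
  also have "\<dots> = prod ratio {m..<k} * ratio k"
    using size_gf_overlists_last_plain[OF assms(1) step.hyps(1)] step.IH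
    by (simp add: ratio_def mult_ac)
  finally show ?case using step by (simp add: prod.atLeastLessThan_Suc)
qed

text \<open>A nonempty list with all sizes at least \<open>m\<close> has total at least
  \<open>m\<close>, so only the empty list contributes below degree \<open>m\<close>. This disposes
  of the remainder after telescoping.\<close>

lemma prod_ratio_nth:
  assumes "1 \<le> m" "m \<le> k" "n < m"
  shows "prod ratio {m..<k} $ n = 1 $ n"
proof -
  have "overlists ({m..<k} \<times> UNIV) \<inter> of_size n = (if n = 0 then {[]} else {})"
  proof -
    have "m \<le> sum_list (map fst ps)" if "ps \<in> overlists ({m..<k} \<times> UNIV)" "ps \<noteq> []" for ps
      using that by (cases ps) (auto simp: overlists_def)
    hence "overlists ({m..<k} \<times> UNIV) \<inter> of_size n \<subseteq> {[]}"
      using assms(3) by (fastforce simp: of_size_def)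
    moreover have "[] \<in> overlists ({m..<k} \<times> UNIV)"
      by (simp add: overlists_def)
    ultimately show ?thesis
      by (auto simp: of_size_def)
  qed
  moreover have "prod ratio {m..<k} $ n = of_nat (card (overlists ({m..<k} \<times> UNIV) \<inter> of_size n))"
    by (simp add: size_gf_overlists_interval[OF assms(1,2), symmetric] size_gf_def)
  ultimately show ?thesis by simp
qed

text \<open>To be read with \<open>x = q^m\<close>, \<open>y = q^t\<close>, the inverses
  \<open>v\<close> and \<open>w\<close> of \<open>1 - x\<close> and \<open>1 - x * y\<close>, and
  \<open>p\<close> the product of the factors common to \<open>A_m\<close> and
  \<open>A_(m+1)\<close>.\<close>

lemma telescoping_identity:
  fixes x y v w p :: "'a :: comm_ring_1"
  assumes "(1 - x) * v = 1" "(1 - x * y) * w = 1"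
  shows "(1 - y) * (w * ((1 + x) * v * p - p)) = (1 + x) * v * p - p * ((1 + x * y) * w)"
proof -
  \<comment> \<open>Writing the last \<open>p\<close> as \<open>(1 - x) * v * p\<close> gives both
    terms the factor \<open>v * w * p\<close>. What remains is
    \<open>2x(1 - y) = (1 - xy)(1 + x) - (1 + xy)(1 - x)\<close>.\<close>
  have "(1 - y) * (w * ((1 + x) * v * p - p)) =
      (1 - y) * (w * ((1 + x) * v * p - ((1 - x) * v) * p))"
    using assms(1) by simp
  also have "\<dots> = ((1 - x * y) * w) * ((1 + x) * v * p) - p * ((1 + x * y) * w) * ((1 - x) * v)"
    by (simp add: algebra_simps)
  finally show ?thesis
    using assms by simp
qed

section \<open>Lists with a prescribed smallest part, and their sum\<close>

context
  fixes t :: nat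
  assumes t: "t \<ge> 1"
begin

text \<open>The lists counted by \<open>S_m\<close>. Subtracting those that avoid \<open>m\<close>
  forces \<open>m\<close> to occur and also removes the empty list.\<close>

definition narrow :: "nat \<Rightarrow> (nat \<times> bool) list set" where
  "narrow m = overlists (insert (m + t, False) ({m..<m + t} \<times> UNIV)) -
     overlists (insert (m + t, False) ({Suc m..<m + t} \<times> UNIV))"

lemma size_gf_narrow:
  assumes "m \<ge> 1"
  shows "(1 - fps_X ^ t) * size_gf (narrow m) =
    prod ratio {m..<m + t} - prod ratio {Suc m..<Suc m + t}"
proof -
  let ?S = "overlists (insert (m + t, False) ({m..<m + t} \<times> UNIV))"
  let ?T = "overlists (insert (m + t, False) ({Suc m..<m + t} \<times> UNIV))"
  define p where "p = prod ratio {Suc m..<m + t}"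
  define w :: "rat fps" where "w = inverse (1 - fps_X ^ (m + t))"
  define v :: "rat fps" where "v = inverse (1 - fps_X ^ m)"
  have "?T \<subseteq> ?S"
    by (rule overlists_mono) auto
  hence "?S = narrow m \<union> ?T"
    by (auto simp: narrow_def)
  moreover have "size_gf (narrow m \<union> ?T) = size_gf (narrow m) + size_gf ?T"
  proof (rule size_gf_Un)
    show "finite (narrow m \<inter> of_size n)" for n
      by (rule finite_subset[OF _ finite_overlists])
        (use assms in \<open>auto simp: narrow_def\<close>)
    show "finite (?T \<inter> of_size n)" for n
      by (rule finite_overlists) (use assms in auto)
  qed (auto simp: narrow_def)
  ultimately have "size_gf (narrow m) = size_gf ?S - size_gf ?T"
    by simp
  \<comment> \<open>As \<open>t \<ge> 1\<close>, the interval \<open>{m..<m + t}\<close> contains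
    \<open>m\<close>, so \<open>ratio m\<close> splits off.\<close>
  also have "size_gf ?S = ratio m * p * w"
    using size_gf_overlists_last_plain[of m "m + t"] size_gf_overlists_interval[of m "m + t"]
      assms t by (simp add: p_def w_def prod.atLeast_Suc_lessThan)
  also have "size_gf ?T = p * w"
    using size_gf_overlists_last_plain[of "Suc m" "m + t"]
      size_gf_overlists_interval[of "Suc m" "m + t"] t by (simp add: p_def w_def)
  also have "(1 - fps_X ^ t) * (ratio m * p * w - p * w) =
      (1 - fps_X ^ t) * (w * ((1 + fps_X ^ m) * v * p - p))"
    by (simp add: ratio_def v_def algebra_simps)
  also have "\<dots> = (1 + fps_X ^ m) * v * p - p * ((1 + fps_X ^ m * fps_X ^ t) * w)"
  proof (rule telescoping_identity)
    show "(1 - fps_X ^ m) * v = 1"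
      unfolding v_def using assms by (rule one_minus_X_power_unit)
    show "(1 - fps_X ^ m * fps_X ^ t) * w = 1"
      unfolding w_def power_add[symmetric] using assms by (intro one_minus_X_power_unit) simp
  qed
  also have "(1 + fps_X ^ m) * v * p = prod ratio {m..<m + t}"
    using t by (simp add: p_def v_def ratio_def prod.atLeast_Suc_lessThan)
  \<comment> \<open>The factor next to \<open>p\<close> is \<open>ratio (m + t)\<close>, which
    completes the shifted window.\<close>
  also have "p * ((1 + fps_X ^ m * fps_X ^ t) * w) = prod ratio {Suc m..<Suc m + t}"
    using t by (simp add: p_def w_def ratio_def power_add)
  finally show ?thesis .
qed

lemma narrow_eq:
  assumes "m \<ge> 1"
  shows "narrow m = {ps \<in> overlists ({1..} \<times> UNIV). ps \<noteq> [] \<and> smallest_part ps = m \<and>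
     largest_part ps - m \<le> t \<and> (largest_part ps - m = t \<longrightarrow> (largest_part ps, True) \<notin> set ps)}"
    (is "_ = ?R")
proof (intro Set.equalityI subsetI)
  fix ps assume "ps \<in> narrow m"
  hence sorted: "sorted_wrt may_precede ps"
    and sub: "set ps \<subseteq> insert (m + t, False) ({m..<m + t} \<times> UNIV)"
    and nsub: "\<not> set ps \<subseteq> insert (m + t, False) ({Suc m..<m + t} \<times> UNIV)"
    by (auto simp: narrow_def overlists_def)
  have ne: "ps \<noteq> []" using nsub by auto
  have bounds: "m \<le> fst p" "fst p \<le> m + t" if "p \<in> set ps" for p
    using sub that by auto
  \<comment> \<open>The two sets of entries differ only in size \<open>m\<close>, so
    \<open>m\<close> occurs in the list.\<close>
  obtain p where p: "p \<in> set ps" "p \<notin> insert (m + t, False) ({Suc m..<m + t} \<times> UNIV)"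
    using nsub by blast
  hence "p \<in> {m..<m + t} \<times> UNIV"
    using sub by blast
  hence "fst p = m"
    using p(2) by auto
  hence small: "smallest_part ps = m"
    using p(1) bounds by (auto simp: smallest_part_def intro!: Min_eqI)
  have large: "largest_part ps \<le> m + t"
    using ne bounds by (auto simp: largest_part_def)
  have pos: "set ps \<subseteq> {1..} \<times> UNIV"
    using sub assms by auto
  have "(m + t, True) \<notin> set ps"
    using sub by auto
  \<comment> \<open>Subtraction on \<open>nat\<close> truncates; \<open>t \<ge> 1\<close> rules out
    the truncated case.\<close>
  moreover have "largest_part ps = m + t" if "largest_part ps - m = t"
    using that t by simp
  ultimately show "ps \<in> ?R"
    using sorted ne small large pos by (auto simp: overlists_def)
next
  fix ps assume "ps \<in> ?R"
  hence sorted: "sorted_wrt may_precede ps" and ne: "ps \<noteq> []" and small: "smallest_part ps = m"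
    and large: "largest_part ps - m \<le> t"
    and plain: "largest_part ps - m = t \<longrightarrow> (largest_part ps, True) \<notin> set ps"
    by (auto simp: overlists_def)
  have lower: "m \<le> fst p" if "p \<in> set ps" for p
    using that small by (auto simp: smallest_part_def)
  have upper: "fst p \<le> largest_part ps" if "p \<in> set ps" for p
    using that by (auto simp: largest_part_def)
  have "set ps \<subseteq> insert (m + t, False) ({m..<m + t} \<times> UNIV)"
  proof
    fix p assume p: "p \<in> set ps"
    obtain a b where ab: "p = (a, b)" by (cases p)
    have "a \<le> largest_part ps" "m \<le> a"
      using lower[OF p] upper[OF p] ab by auto
    moreover have "a \<le> m + t"
      using \<open>a \<le> largest_part ps\<close> large by linarith
    \<comment> \<open>A part \<open>m + t\<close> must be the largest one, and the difference is
      then exactly \<open>t\<close>.\<close>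
    moreover have "\<not> b" if "a = m + t"
    proof -
      have "largest_part ps = m + t"
        using that \<open>a \<le> largest_part ps\<close> large by linarith
      thus ?thesis using plain p ab that by auto
    qed
    ultimately show "p \<in> insert (m + t, False) ({m..<m + t} \<times> UNIV)"
      using ab by (cases "a = m + t") auto
  qed
  moreover have "m \<in> fst ` set ps"
    using ne small Min_in[of "fst ` set ps"] by (auto simp: smallest_part_def)
  hence "\<not> set ps \<subseteq> insert (m + t, False) ({Suc m..<m + t} \<times> UNIV)"
    using t by auto
  ultimately show "ps \<in> narrow m"
    using sorted by (auto simp: narrow_def overlists_def)
qed

text \<open>Classification by the smallest part, which lies between 1 and \<open>n\<close>.\<close>

lemma g_eq_sum:
  assumes "n \<ge> 1"
  shows "g t n = (\<Sum>m=1..n. card (narrow m \<inter> of_size n))"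
proof -
  have "1 \<le> smallest_part ps \<and> smallest_part ps \<le> n"
    if "ps \<in> overlists ({1..} \<times> UNIV)" "ps \<in> of_size n" "ps \<noteq> []" for ps
  proof -
    have "smallest_part ps \<in> fst ` set ps"
      unfolding smallest_part_def using that by (intro Min_in) auto
    then obtain p where p: "p \<in> set ps" "fst p = smallest_part ps" by auto
    have "fst p \<le> sum_list (map fst ps)"
      using p(1) by (intro member_le_sum_list) auto
    thus ?thesis
      using p that by (auto simp: overlists_def of_size_def)
  qed
  \<comment> \<open>Since \<open>n \<ge> 1\<close>, the empty list, with its unspecified
    \<open>Min\<close>, does not arise.\<close>
  moreover have "ps \<noteq> []" if "ps \<in> of_size n" for ps
    using that assms by (auto simp: of_size_def)
  ultimately have "{ps \<in> overpartitions n. largest_part ps - smallest_part ps \<le> t \<and>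
      (largest_part ps - smallest_part ps = t \<longrightarrow> (largest_part ps, True) \<notin> set ps)} =
      (\<Union>m\<in>{1..n}. narrow m \<inter> of_size n)"
    by (auto simp: overpartitions_eq narrow_eq)
  hence "g t n = card (\<Union>m\<in>{1..n}. narrow m \<inter> of_size n)"
    by (simp add: g_def)
  also have "\<dots> = (\<Sum>m=1..n. card (narrow m \<inter> of_size n))"
  proof (rule card_UN_disjoint)
    show "\<forall>m\<in>{1..n}. finite (narrow m \<inter> of_size n)"
    proof
      fix m assume "m \<in> {1..n}"
      thus "finite (narrow m \<inter> of_size n)"
        by (intro finite_subset[OF _ finite_overlists[OF order_refl, of n]]) (auto simp: narrow_eq)
    qed
  qed (auto simp: narrow_eq)
  finally show ?thesis .
qed

text \<open>Coefficient \<open>n\<close> involves only \<open>m \<le> n\<close>, so a finite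
  telescoping sum replaces the infinite one, with remainder \<open>A_(n+1)\<close>.\<close>

lemma gf_eq:
  "Abs_fps (\<lambda>n. if n \<ge> 1 then of_nat (g t n) else 0) =
    inverse (1 - fps_X ^ t) * (prod ratio {1..<Suc t} - 1)"
proof (rule fps_ext)
  fix n
  define w :: "rat fps" where "w = inverse (1 - fps_X ^ t)"
  have "(1 - fps_X ^ t) * (\<Sum>m=1..n. size_gf (narrow m)) =
      (\<Sum>m=1..n. prod ratio {m..<m + t} - prod ratio {Suc m..<Suc m + t})"
    unfolding sum_distrib_left by (rule sum.cong) (simp_all only: size_gf_narrow atLeastAtMost_iff)
  also have "\<dots> = prod ratio {1..<1 + t} - prod ratio {Suc n..<Suc n + t}"
    by (induction n) (simp_all)
  finally have "(\<Sum>m=1..n. size_gf (narrow m)) * (1 - fps_X ^ t) =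
      prod ratio {1..<1 + t} - prod ratio {Suc n..<Suc n + t}"
    by (simp only: mult.commute)
  hence "(\<Sum>m=1..n. size_gf (narrow m)) =
      (prod ratio {1..<1 + t} - prod ratio {Suc n..<Suc n + t}) * w"
    unfolding w_def using one_minus_X_power_unit[OF t] by (rule eq_mult_right_inverse)
  hence "(\<Sum>m=1..n. size_gf (narrow m)) $ n =
      (w * (prod ratio {1..<1 + t} - prod ratio {Suc n..<Suc n + t})) $ n"
    by (simp only: mult.commute)
  \<comment> \<open>Only degrees up to \<open>n\<close> enter this coefficient, and there the
    remainder agrees with 1.\<close>
  also have "\<dots> = (w * (prod ratio {1..<1 + t} - 1)) $ n"
    unfolding fps_mult_nth
    by (rule sum.cong)
      (auto simp: prod_ratio_nth simp del: fps_one_nth prod.op_ivl_Suc)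
  \<comment> \<open>For \<open>n = 0\<close> the sum over \<open>m\<close> is empty, matching the
    default coefficient 0.\<close>
  finally show "Abs_fps (\<lambda>n. if n \<ge> 1 then of_nat (g t n) else 0) $ n =
      (inverse (1 - fps_X ^ t) * (prod ratio {1..<Suc t} - 1)) $ n"
    by (cases "n \<ge> 1") (simp_all add: g_eq_sum w_def fps_sum_nth size_gf_def)
qed

end

text \<open>Factor \<open>k\<close> of the two Pochhammer products is \<open>1 + q^(k+1)\<close> and
  \<open>1 - q^(k+1)\<close>, so their quotient is \<open>ratio (k + 1)\<close>.\<close>

lemma prod_ratio_eq_qpochhammer:
  "prod ratio {1..<Suc t} = qpochhammer (- fps_X) fps_X t / qpochhammer fps_X fps_X t"
proof -
  \<comment> \<open>A nonzero constant term makes the denominator invertible, so division is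
    multiplication by the inverse.\<close>
  have unit: "qpochhammer fps_X fps_X t $ 0 \<noteq> (0 :: rat)"
    by (induction t) (simp_all add: qpochhammer_def)
  have "prod ratio {1..<Suc t} * qpochhammer fps_X fps_X t = qpochhammer (- fps_X) fps_X t"
  proof (induction t)
    case 0
    show ?case by (simp add: qpochhammer_def)
  next
    case (Suc t)
    have "(1 - fps_X ^ Suc t :: rat fps) * inverse (1 - fps_X ^ Suc t) = 1"
      by (rule one_minus_X_power_unit) simp
    hence "ratio (Suc t) * (1 - fps_X * fps_X ^ t) = 1 + fps_X * fps_X ^ t"
      by (simp add: ratio_def mult_ac)
    moreover have "prod ratio {1..<Suc (Suc t)} = prod ratio {1..<Suc t} * ratio (Suc t)"
      by simp
    ultimately show ?case
      using Suc.IH unfolding qpochhammer_def lessThan_Suc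
      by (simp add: mult_ac)
  qed
  hence "prod ratio {1..<Suc t} =
      qpochhammer (- fps_X) fps_X t * inverse (qpochhammer fps_X fps_X t)"
    using inverse_mult_eq_1'[OF unit] by (rule eq_mult_right_inverse)
  thus ?thesis
    by (simp only: fps_divide_unit[OF unit])
qed

theorem theorem1:
  fixes t :: nat
  assumes "t \<ge> 1"
  shows "Abs_fps (\<lambda>n. if n \<ge> 1 then of_nat (g t n) else 0) =
    (1 / (1 - fps_X ^ t) *
      (qpochhammer (- fps_X) fps_X t / qpochhammer fps_X fps_X t - 1) :: rat fps)"
  using assms by (simp only: gf_eq prod_ratio_eq_qpochhammer) (simp add: fps_divide_unit)

end
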